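(* Let $\mathcal{X}$ be a separable Banach space, let $\{m_n\}$ be an increasing sequence of positive integers, let $\mathcal{X}_d$ be a BK-space, and let $\{h_{n,i}\}_{n\in\mathbb{N},\,1\le i\le m_n}\subseteq\mathcal{X}^*$ be an approximative $\mathcal{X}_d$-frame for $\mathcal{X}$ with bounds $A$, $B$. Let $\{x_n\}\subseteq\mathcal{X}$, and suppose that the operator $T:\mathcal{X}_d\to\mathcal{X}$ given by $T(\{c_{n,i}\})=\lim_{n\to\infty}\sum_{i=1}^{m_n}c_{n,i}x_i$ is well defined (i.e. this limit exists in $\mathcal{X}$ for every $\{c_{n,i}\}\in\mathcal{X}_d$). Then there exists a linear operator $K\in L(\mathcal{X})$ such that $(\{x_n\},\{h_{n,i}\})$ is an approximative $K$-atomic decomposition for $\mathcal{X}$ with respect to $\mathcal{X}_d$.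
   Context: Scalars are $\mathbb{R}$ or $\mathbb{C}$. $L(\mathcal{X})$ is the space of bounded linear operators on $\mathcal{X}$, and $\mathcal{X}^*$ is the dual space. Given an increasing sequence $\{m_n\}_{n\in\mathbb{N}}$ of positive integers, a BK-space $\mathcal{X}_d$ here is a Banach space whose elements are scalar families $\{c_{n,i}\}_{n\in\mathbb{N},\,1\le i\le m_n}$ (with coordinatewise linear operations) and on which every coordinate functional is continuous. Definition. A family $\{h_{n,i}\}_{n\in\mathbb{N},\,1\le i\le m_n}\subseteq\mathcal{X}^*$ is an approximative $\mathcal{X}_d$-frame for $\mathcal{X}$ with bounds $A,B$ (where $0<A\le B<\infty$) if $\{h_{n,i}(x)\}\in\mathcal{X}_d$ for all $x\in\mathcal{X}$ and $A\|x\|_{\mathcal{X}}\le\|\{h_{n,i}(x)\}\|_{\mathcal{X}_d}\le B\|x\|_{\mathcal{X}}$ for all $x\in\mathcal{X}$. Definition. Let $K\in L(\mathcal{X})$, $\{x_n\}\subset\mathcal{X}$, and $\{h_{n,i}\}_{n\in\mathbb{N},\,1\le i\le m_n}\subset\mathcal{X}^*$. The pair $(\{x_n\},\{h_{n,i}\})$ is an approximative $K$-atomic decomposition for $\mathcal{X}$ with respect to $\mathcal{X}_d$ if: (a) $\{h_{n,i}(x)\}_{n\in\mathbb{N},1\le i\le m_n}\in\mathcal{X}_d$ for all $x\in\mathcal{X}$; (b) there are constants $0<A'\le B'<\infty$ with $A'\|K(x)\|_{\mathcal{X}}\le \|\{h_{n,i}(x)\}\|_{\mathcal{X}_d}\le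 B'\|x\|_{\mathcal{X}}$ for all $x\in\mathcal{X}$; (c) for all $x\in\mathcal{X}$ the limit $\lim_{n\to\infty}\sum_{i=1}^{m_n}h_{n,i}(x)x_i$ exists in $\mathcal{X}$ and equals $K(x)$. *)

theory Defs
  imports "HOL-Analysis.Analysis" "HOL-Library.Function_Algebras"
begin

text \<open>
  Scalars are a type of class \<open>real_normed_field\<close>, i.e. a commutative field carrying a
  real algebra structure and a multiplicative norm.  By Gelfand-Mazur such a field is
  isometrically isomorphic to the reals or to the complex numbers, and both types are instances,
  so the class expresses exactly ``the scalars are real or complex''.

  A Banach space over the scalars is a type of class \<open>banach\<close> (completeness and the norm)
  together with a scalar multiplication that extends \<open>(*\<^sub>R)\<close> and is compatible with the norm.
\<close>

locale scalar_normed_space = vector_space smul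
  for smul :: "'k::real_normed_field \<Rightarrow> 'a::real_normed_vector \<Rightarrow> 'a" +
  assumes scale_of_real: "smul (of_real r) x = r *\<^sub>R x"
    and norm_scale: "norm (smul a x) = norm a * norm x"

lemma scalar_normed_space_real:
  "scalar_normed_space ((*\<^sub>R) :: real \<Rightarrow> 'a::real_normed_vector \<Rightarrow> 'a)"
  by unfold_locales (auto simp: algebra_simps)

lemma scalar_normed_space_field:
  "scalar_normed_space ((*) :: 'k::real_normed_field \<Rightarrow> 'k \<Rightarrow> 'k)"
  by unfold_locales (auto simp: algebra_simps norm_mult scaleR_conv_of_real)

text \<open>\<open>bounded_linear\<close> alone only means real-linear; linearity over the scalars is
  the second conjunct.\<close>

definition bounded_operator ::
  "('k::real_normed_field \<Rightarrow> 'a::real_normed_vector \<Rightarrow> 'a) \<Rightarrow>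
   ('k \<Rightarrow> 'b::real_normed_vector \<Rightarrow> 'b) \<Rightarrow> ('a \<Rightarrow> 'b) \<Rightarrow> bool" where
  "bounded_operator smul1 smul2 f \<longleftrightarrow>
     bounded_linear f \<and> Vector_Spaces.linear smul1 smul2 f"

abbreviation bounded_functional ::
  "('k::real_normed_field \<Rightarrow> 'a::real_normed_vector \<Rightarrow> 'a) \<Rightarrow> ('a \<Rightarrow> 'k) \<Rightarrow> bool" where
  "bounded_functional smul f \<equiv> bounded_operator smul (*) f"

text \<open>
  A family \<open>c\<^sub>n\<^sub>,\<^sub>i\<close> with \<open>1 \<le> i \<le> m\<^sub>n\<close> is represented by a function
  \<open>nat \<Rightarrow> nat \<Rightarrow> 'k\<close> that vanishes outside the index range; on such functions the pointwise
  operations are the coordinatewise ones.  The outer index starts at \<open>0\<close>.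
\<close>

definition family :: "(nat \<Rightarrow> nat) \<Rightarrow> (nat \<Rightarrow> nat \<Rightarrow> 'k::zero) \<Rightarrow> nat \<Rightarrow> nat \<Rightarrow> 'k" where
  "family m c = (\<lambda>n i. if i \<in> {1..m n} then c n i else 0)"

text \<open>The value off the carrier is irrelevant, but \<open>Metric_space\<close> requires a symmetric
  nonnegative function on the whole type.\<close>

definition carrier_dist :: "'c set \<Rightarrow> ('c \<Rightarrow> real) \<Rightarrow> 'c \<Rightarrow> 'c::minus \<Rightarrow> real" where
  "carrier_dist E N c d = (if c \<in> E \<and> d \<in> E then N (c - d) else 0)"

locale bk_space =
  fixes m :: "nat \<Rightarrow> nat"
    and E :: "(nat \<Rightarrow> nat \<Rightarrow> 'k::real_normed_field) set"
    and N :: "(nat \<Rightarrow> nat \<Rightarrow> 'k) \<Rightarrow> real"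
  assumes family_mem: "c \<in> E \<Longrightarrow> family m c = c"
    and zero_mem: "0 \<in> E"
    and add_mem: "c \<in> E \<Longrightarrow> d \<in> E \<Longrightarrow> c + d \<in> E"
    and scale_mem: "c \<in> E \<Longrightarrow> (\<lambda>n i. a * c n i) \<in> E"
    and N_nonneg: "c \<in> E \<Longrightarrow> 0 \<le> N c"
    and N_eq_0: "c \<in> E \<Longrightarrow> N c = 0 \<longleftrightarrow> c = 0"
    and N_triangle: "c \<in> E \<Longrightarrow> d \<in> E \<Longrightarrow> N (c + d) \<le> N c + N d"
    and N_scale: "c \<in> E \<Longrightarrow> N (\<lambda>n i. a * c n i) = norm a * N c"
    and complete: "Metric_space.mcomplete E (carrier_dist E N)"
    and coordinate_continuous: "i \<in> {1..m n} \<Longrightarrow>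
      continuous_map (Metric_space.mtopology E (carrier_dist E N)) euclidean (\<lambda>c. c n i)"
begin

lemma uminus_mem: "c \<in> E \<Longrightarrow> - c \<in> E"
  using scale_mem[of c "-1"] by (simp add: fun_Compl_def)

lemma N_uminus: "c \<in> E \<Longrightarrow> N (- c) = N c"
  using N_scale[of c "-1"] by (simp add: fun_Compl_def)

lemma diff_mem: "c \<in> E \<Longrightarrow> d \<in> E \<Longrightarrow> c - d \<in> E"
  using add_mem[OF _ uminus_mem, of c d] by simp

sublocale Metric_space E "carrier_dist E N"
proof
  show "0 \<le> carrier_dist E N c d" for c d
    by (simp add: carrier_dist_def N_nonneg diff_mem)
  show "carrier_dist E N c d = carrier_dist E N d c" for c d
    using N_uminus[OF diff_mem, of c d] by (simp add: carrier_dist_def)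
  show "carrier_dist E N c d = 0 \<longleftrightarrow> c = d" if "c \<in> E" "d \<in> E" for c d
    using that by (simp add: carrier_dist_def N_eq_0 diff_mem)
  show "carrier_dist E N c e \<le> carrier_dist E N c d + carrier_dist E N d e"
    if "c \<in> E" "d \<in> E" "e \<in> E" for c d e
    using that N_triangle[OF diff_mem diff_mem, of c d d e] by (simp add: carrier_dist_def)
qed

end

definition approximative_frame ::
  "('k::real_normed_field \<Rightarrow> 'a::banach \<Rightarrow> 'a) \<Rightarrow> (nat \<Rightarrow> nat) \<Rightarrow>
   (nat \<Rightarrow> nat \<Rightarrow> 'k) set \<Rightarrow> ((nat \<Rightarrow> nat \<Rightarrow> 'k) \<Rightarrow> real) \<Rightarrow>
   (nat \<Rightarrow> nat \<Rightarrow> 'a \<Rightarrow> 'k) \<Rightarrow> real \<Rightarrow> real \<Rightarrow> bool" where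
  "approximative_frame smul m E N h A B \<longleftrightarrow>
     (\<forall>n. \<forall>i\<in>{1..m n}. bounded_functional smul (h n i)) \<and>
     0 < A \<and> A \<le> B \<and>
     (\<forall>x. family m (\<lambda>n i. h n i x) \<in> E) \<and>
     (\<forall>x. A * norm x \<le> N (family m (\<lambda>n i. h n i x)) \<and>
          N (family m (\<lambda>n i. h n i x)) \<le> B * norm x)"

definition approximative_K_atomic_decomposition ::
  "('k::real_normed_field \<Rightarrow> 'a::banach \<Rightarrow> 'a) \<Rightarrow> (nat \<Rightarrow> nat) \<Rightarrow>
   (nat \<Rightarrow> nat \<Rightarrow> 'k) set \<Rightarrow> ((nat \<Rightarrow> nat \<Rightarrow> 'k) \<Rightarrow> real) \<Rightarrow>
   ('a \<Rightarrow> 'a) \<Rightarrow> (nat \<Rightarrow> 'a) \<Rightarrow> (nat \<Rightarrow> nat \<Rightarrow> 'a \<Rightarrow> 'k) \<Rightarrow> bool" where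
  "approximative_K_atomic_decomposition smul m E N K x h \<longleftrightarrow>
     bounded_operator smul smul K \<and>
     (\<forall>n. \<forall>i\<in>{1..m n}. bounded_functional smul (h n i)) \<and>
     (\<forall>y. family m (\<lambda>n i. h n i y) \<in> E) \<and>
     (\<exists>A' B'. 0 < A' \<and> A' \<le> B' \<and>
        (\<forall>y. A' * norm (K y) \<le> N (family m (\<lambda>n i. h n i y)) \<and>
             N (family m (\<lambda>n i. h n i y)) \<le> B' * norm y)) \<and>
     (\<forall>y. (\<lambda>n. \<Sum>i=1..m n. smul (h n i y) (x i)) \<longlonglongrightarrow> K y)"

end

theory Submission
  imports Defs
begin

text \<open>
  The operator is \<open>K y = lim\<^sub>n S\<^sub>n y\<close> with \<open>S\<^sub>n y = (\<Sum>i=1..m n. smul (h n i y) (x i))\<close>; that is,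
  \<open>K\<close> is the synthesis map \<open>T\<close> applied to the coefficient family of \<open>y\<close>.  The limit exists because
  that family lies in \<open>Xd\<close>, and it inherits scalar linearity from the \<open>S\<^sub>n\<close>.

  The analytic content is the continuity of \<open>K\<close>.  Each \<open>S\<^sub>n\<close> is a finite sum of bounded rank-one
  operators, so \<open>K\<close> is a pointwise limit of bounded operators on a Banach space and is bounded by
  the Banach-Steinhaus theorem (\<open>uniform_boundedness\<close>, \<open>bounded_linear_pointwise_limit\<close>).  Working
  with the \<open>S\<^sub>n\<close> on the Banach space itself, rather than with the partial sums of \<open>T\<close> on \<open>Xd\<close>, makes
  the type-class norm available throughout.

  The upper frame bound for \<open>K\<close> is the one of the given frame.  For the lower one, a bound
  \<open>norm (K y) \<le> C * norm y\<close> turns \<open>A * norm y \<le> Nd (\<dots>)\<close> into \<open>(A / C) * norm (K y) \<le> Nd (\<dots>)\<close>.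
\<close>

text \<open>
  The closed sets \<open>{y. \<forall>n. norm (f n y) \<le> k}\<close> exhaust the space as \<open>k\<close> grows, so by Baire's
  theorem one of them contains a ball; translating and rescaling this ball yields a bound that is
  uniform in \<open>n\<close>.
\<close>
lemma uniform_boundedness:
  fixes f :: "nat \<Rightarrow> 'a::banach \<Rightarrow> 'b::real_normed_vector"
  assumes lin: "\<And>n. bounded_linear (f n)"
    and ptw: "\<And>y. Bseq (\<lambda>n. f n y)"
  obtains C where "0 < C" "\<And>n y. norm (f n y) \<le> C * norm y"
proof -
  define F where "F k = {y. \<forall>n. norm (f n y) \<le> real k}" for k :: nat
  have closed: "closed (F k)" for k
    unfolding F_def
    by (intro closed_Collect_all closed_Collect_le continuous_intros
        linear_continuous_on lin)
  have "y \<in> (\<Union>k. F k)" for y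
  proof -
    obtain b where "\<And>n. norm (f n y) \<le> b"
      using ptw[of y] unfolding Bseq_def by blast
    moreover obtain k :: nat where "b \<le> real k"
      using real_arch_simple by blast
    ultimately have "y \<in> F k"
      unfolding F_def by (auto intro: order_trans)
    then show ?thesis by blast
  qed
  then have cover: "(\<Union>k. F k) = UNIV"
    by blast
  have "\<exists>k. interior (F k) \<noteq> {}"
  proof (rule ccontr)
    assume "\<nexists>k. interior (F k) \<noteq> {}"
    then have "Met_TC.mtopology interior_of \<Union>(range F) = {}"
      by (intro Met_TC.metric_Baire_category_alt)
        (auto simp: closed complete_UNIV interior_of_def interior_def)
    then show False
      by (simp add: cover interior_of_def) (use open_UNIV in blast)
  qed
  then obtain k z where "z \<in> interior (F k)"
    by blast
  then obtain r where r: "0 < r" "cball z r \<subseteq> F k"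
    using mem_interior_cball by blast
  have bound: "norm (f n y) \<le> 2 * real k / r * norm y" for n y
  proof (cases "y = 0")
    case True
    then show ?thesis
      by (simp add: linear_0[OF bounded_linear.linear[OF lin]])
  next
    case False
    let ?t = "r / norm y"
    have "z + ?t *\<^sub>R y \<in> F k" "z \<in> F k"
      using r False by (auto simp: dist_norm intro!: subsetD[OF r(2)])
    then have le: "norm (f n (z + ?t *\<^sub>R y)) \<le> k" "norm (f n z) \<le> k"
      by (auto simp: F_def)
    have "?t *\<^sub>R f n y = f n (z + ?t *\<^sub>R y) - f n z"
      by (simp add: bounded_linear.linear[OF lin] linear_add linear_cmul)
    then have "norm (?t *\<^sub>R f n y) \<le> 2 * real k"
      using norm_triangle_ineq4[of "f n (z + ?t *\<^sub>R y)" "f n z"] le by simp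
    then show ?thesis
      using False r by (simp add: field_simps)
  qed
  show ?thesis
  proof (rule that)
    \<comment> \<open>Adding 1 keeps the constant positive when \<open>k = 0\<close>.\<close>
    show "0 < 2 * real k / r + 1"
      using r by (simp add: add_nonneg_pos)
    show "norm (f n y) \<le> (2 * real k / r + 1) * norm y" for n y
      using bound[of n y] norm_ge_zero[of y] unfolding distrib_right by linarith
  qed
qed

lemma bounded_linear_pointwise_limit:
  fixes f :: "nat \<Rightarrow> 'a::banach \<Rightarrow> 'b::real_normed_vector"
  assumes lin: "\<And>n. bounded_linear (f n)"
    and lim: "\<And>y. (\<lambda>n. f n y) \<longlonglongrightarrow> g y"
  shows "bounded_linear g"
proof -
  have "Bseq (\<lambda>n. f n y)" for y
    using lim by (intro convergent_imp_Bseq convergentI)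
  then obtain C where C: "\<And>n y. norm (f n y) \<le> C * norm y"
    using uniform_boundedness[of f] lin by blast
  note linear = bounded_linear.linear[OF lin]
  show ?thesis
  proof (rule bounded_linear_intro[where K = C])
    show "g (y + z) = g y + g z" for y z
      using lim[of "y + z"] tendsto_add[OF lim[of y] lim[of z]]
      by (simp add: linear_add[OF linear] LIMSEQ_unique)
    show "g (r *\<^sub>R y) = r *\<^sub>R g y" for r y
      using lim[of "r *\<^sub>R y"] tendsto_scaleR[OF tendsto_const lim[of y]]
      by (simp add: linear_cmul[OF linear] LIMSEQ_unique)
    show "norm (g y) \<le> norm y * C" for y
      using tendsto_norm[OF lim[of y]] C
      by (intro LIMSEQ_le_const2) (auto simp: mult.commute)
  qed
qed

context scalar_normed_space
begin

lemma bounded_operator_rank_one: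
  assumes "bounded_functional smul g"
  shows "bounded_operator smul smul (\<lambda>y. smul (g y) v)"
proof -
  from assms have bl: "bounded_linear g" and l: "Vector_Spaces.linear smul (*) g"
    by (auto simp: bounded_operator_def)
  obtain C where C: "\<And>y. norm (g y) \<le> norm y * C"
    using bounded_linear.bounded[OF bl] by blast
  have "bounded_linear (\<lambda>y. smul (g y) v)"
  proof (rule bounded_linear_intro[where K = "C * norm v"])
    show "smul (g (y + z)) v = smul (g y) v + smul (g z) v" for y z
      using l by (simp add: Vector_Spaces.linear_iff scale_left_distrib)
    show "smul (g (r *\<^sub>R y)) v = r *\<^sub>R smul (g y) v" for r y
    proof -
      \<comment> \<open>Real homogeneity is scalar homogeneity at \<open>of_real r\<close>, transported by \<open>scale_of_real\<close>
        on both sides.\<close>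
      have "g (r *\<^sub>R y) = of_real r * g y"
        using l by (simp add: Vector_Spaces.linear_iff flip: scale_of_real)
      then show ?thesis
        by (simp flip: scale_of_real)
    qed
    show "norm (smul (g y) v) \<le> norm y * (C * norm v)" for y
      using mult_right_mono[OF C[of y] norm_ge_zero[of v]] by (simp add: norm_scale ac_simps)
  qed
  moreover have "Vector_Spaces.linear smul smul (\<lambda>y. smul (g y) v)"
    using l by (simp add: Vector_Spaces.linear_iff vector_space_axioms scale_left_distrib)
  ultimately show ?thesis
    by (simp add: bounded_operator_def)
qed

lemma bounded_operator_sum:
  assumes "\<And>i. i \<in> I \<Longrightarrow> bounded_operator smul smul (f i)"
  shows "bounded_operator smul smul (\<lambda>y. \<Sum>i\<in>I. f i y)"
proof -
  have "bounded_linear (\<lambda>y. \<Sum>i\<in>I. f i y)"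
    using assms by (intro bounded_linear_sum) (simp add: bounded_operator_def)
  moreover have "(\<Sum>i\<in>I. f i (y + z)) = (\<Sum>i\<in>I. f i y) + (\<Sum>i\<in>I. f i z)" for y z
    unfolding sum.distrib[symmetric] using assms
    by (intro sum.cong) (simp_all add: bounded_operator_def Vector_Spaces.linear_iff)
  moreover have "(\<Sum>i\<in>I. f i (smul a y)) = smul a (\<Sum>i\<in>I. f i y)" for a y
    unfolding scale_sum_right using assms
    by (intro sum.cong) (simp_all add: bounded_operator_def Vector_Spaces.linear_iff)
  ultimately show ?thesis
    by (simp add: bounded_operator_def Vector_Spaces.linear_iff vector_space_axioms)
qed

lemma bounded_linear_scale: "bounded_linear (smul a)"
proof (rule bounded_linear_intro[where K = "norm a"])
  show "smul a (r *\<^sub>R y) = r *\<^sub>R smul a y" for r y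
    by (simp add: mult.commute flip: scale_of_real)
qed (simp_all add: scale_right_distrib norm_scale mult.commute)

end

lemma bounded_operator_pointwise_limit:
  fixes smul :: "'k::real_normed_field \<Rightarrow> 'a::banach \<Rightarrow> 'a"
  assumes "scalar_normed_space smul"
    and op: "\<And>n. bounded_operator smul smul (f n)"
    and lim: "\<And>y. (\<lambda>n. f n y) \<longlonglongrightarrow> g y"
  shows "bounded_operator smul smul g"
proof -
  interpret scalar_normed_space smul by fact
  have "bounded_linear g"
    by (rule bounded_linear_pointwise_limit[OF _ lim])
      (use op in \<open>simp add: bounded_operator_def\<close>)
  moreover have "g (smul a y) = smul a (g y)" for a y
  proof (rule LIMSEQ_unique[OF lim])
    have "f n (smul a y) = smul a (f n y)" for n
      using op by (simp add: bounded_operator_def Vector_Spaces.linear_iff)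
    then show "(\<lambda>n. f n (smul a y)) \<longlonglongrightarrow> smul a (g y)"
      using bounded_linear.tendsto[OF bounded_linear_scale lim[of y]] by simp
  qed
  ultimately show ?thesis
    using linear_add[OF bounded_linear.linear[of g]]
    by (simp add: bounded_operator_def Vector_Spaces.linear_iff vector_space_axioms)
qed

theorem theorem3p3:
  fixes smul :: "'k::real_normed_field \<Rightarrow> 'a::banach \<Rightarrow> 'a"
    and m :: "nat \<Rightarrow> nat"
    and Xd :: "(nat \<Rightarrow> nat \<Rightarrow> 'k) set"
    and Nd :: "(nat \<Rightarrow> nat \<Rightarrow> 'k) \<Rightarrow> real"
    and h :: "nat \<Rightarrow> nat \<Rightarrow> 'a \<Rightarrow> 'k"
    and x :: "nat \<Rightarrow> 'a"
    and A B :: real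
  assumes "scalar_normed_space smul"
    and "separable_space (euclidean :: 'a topology)"
    and "mono m" and "\<And>n. 0 < m n"
    and "bk_space m Xd Nd"
    and "approximative_frame smul m Xd Nd h A B"
    and "\<And>c. c \<in> Xd \<Longrightarrow> convergent (\<lambda>n. \<Sum>i=1..m n. smul (c n i) (x i))"
  shows "\<exists>K. bounded_operator smul smul K \<and>
               approximative_K_atomic_decomposition smul m Xd Nd K x h"
proof -
  interpret scalar_normed_space smul by fact
  from assms(6) have h: "\<And>n i. i \<in> {1..m n} \<Longrightarrow> bounded_functional smul (h n i)"
    and AB: "0 < A" "A \<le> B"
    and mem: "\<And>y. family m (\<lambda>n i. h n i y) \<in> Xd"
    and lower: "\<And>y. A * norm y \<le> Nd (family m (\<lambda>n i. h n i y))"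
    and upper: "\<And>y. Nd (family m (\<lambda>n i. h n i y)) \<le> B * norm y"
    by (auto simp: approximative_frame_def)
  define S where "S n y = (\<Sum>i=1..m n. smul (h n i y) (x i))" for n y
  define K where "K y = lim (\<lambda>n. S n y)" for y
  have "convergent (\<lambda>n. S n y)" for y
  proof -
    have "S n y = (\<Sum>i=1..m n. smul (family m (\<lambda>n i. h n i y) n i) (x i))" for n
      unfolding S_def by (intro sum.cong) (auto simp: family_def)
    then show ?thesis
      using assms(7)[OF mem[of y]] by simp
  qed
  then have lim: "(\<lambda>n. S n y) \<longlonglongrightarrow> K y" for y
    by (simp add: K_def convergent_LIMSEQ_iff)
  have "bounded_operator smul smul (S n)" for n
    unfolding S_def by (intro bounded_operator_sum bounded_operator_rank_one h)
  then have K: "bounded_operator smul smul K"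
    using lim by (rule bounded_operator_pointwise_limit[OF assms(1)])
  then obtain C0 where C0: "\<And>y. norm (K y) \<le> norm y * C0"
    unfolding bounded_operator_def by (metis bounded_linear.bounded)
  \<comment> \<open>Taking \<open>1 \<le> C\<close> makes \<open>A / C \<le> B\<close> as well as \<open>0 < A / C\<close>.\<close>
  define C where "C = max 1 C0"
  have C: "1 \<le> C" "norm (K y) \<le> C * norm y" for y
    using C0[of y] mult_left_mono[of C0 C "norm y"] by (auto simp: C_def mult.commute)
  have "A / C * norm (K y) \<le> Nd (family m (\<lambda>n i. h n i y))" for y
  proof -
    have "A / C * norm (K y) \<le> A / C * (C * norm y)"
      using C AB by (intro mult_left_mono) auto
    also have "\<dots> = A * norm y"
      using C(1) by simp
    finally show ?thesis
      using lower[of y] by linarith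
  qed
  moreover have "0 < A / C" "A / C \<le> B"
    using AB C(1) by (auto simp: divide_le_eq intro: order_trans[OF _ mult_left_mono[of 1 C B]])
  ultimately have "approximative_K_atomic_decomposition smul m Xd Nd K x h"
    unfolding approximative_K_atomic_decomposition_def
    using K h mem upper lim[unfolded S_def] by blast
  with K show ?thesis
    by blast
qed

end
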